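(* If $n\ge 3$ and $C_n^\phi$ is a mixed cycle of order $n$, then $$|[C_n^\phi]|=\begin{cases}\frac{3^n+1}{4} & \text{if } n \text{ is odd and } \zeta_{C_n^\phi}(C_n)\in\{1,\pm\mathbf{i}\},\\[2pt] \frac{3^n-3}{4} & \text{if } n \text{ is odd and } \zeta_{C_n^\phi}(C_n)=-1,\\[2pt] \frac{3^n+3}{4} & \text{if } n \text{ is even and } \zeta_{C_n^\phi}(C_n)=1,\\[2pt] \frac{3^n-1}{4} & \text{if } n \text{ is even and } \zeta_{C_n^\phi}(C_n)\in\{-1,\pm\mathbf{i}\}.\end{cases}$$
   Context: $C_n$ is the (undirected) cycle graph on $n$ vertices. A partial orientation $\phi$ of an undirected graph $G$ chooses a subset $S\subseteq E(G)$ and one of the two directions for each edge in $S$; the resulting mixed graph is $G^\phi$ (edges outside $S$ remain undirected). The Hermitian adjacency matrix $H(G^\phi)=[h_{uv}]$ has $h_{uv}=1$ if $uv$ is an undirected edge, $h_{uv}=\mathbf{i}$ if the edge is directed from $u$ to $v$, $h_{uv}=-\mathbf{i}$ if it is directed from $v$ to $u$, and $0$ otherwise, where $\mathbf{i}=\sqrt{-1}$. For a cycle $C=u_1u_2\ldots u_ku_1$ of $G$ (with a fixed direction of traversal) its gain is $\zeta_{G^\phi}(C)=h_{u_1u_2}h_{u_2u_3}\cdots h_{u_ku_1}$. Mixed graphs $G^\phi,G^\gamma$ are switching equivalent if $D^{-1}H(G^\phi)D=H(G^\gamma)$ for some diagonal matrix $D$ with diagonal entries in $\{1,-1,\mathbf{i},-\mathbf{i}\}$.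 The switching equivalence class $[G^\phi]$ is the set of all mixed graphs $G^\gamma$ (on the same labelled underlying graph $G$) that are switching equivalent to $G^\phi$. *)

theory Defs
  imports Complex_Main "Jordan_Normal_Form.Matrix"
begin

text \<open>
  Graphs of order \<open>n\<close> have vertex set \<open>{0..<n}\<close> and are given by a set \<open>E\<close> of
  two-element vertex sets.
\<close>

definition cycle_edges :: "nat \<Rightarrow> nat set set" where
  "cycle_edges n = {{i, Suc i mod n} | i. i < n}"

text \<open>
  A partial orientation is represented by its set \<open>A\<close> of arcs: the chosen subset of \<open>E\<close> is
  \<open>{{u, v} | u v. (u, v) \<in> A}\<close>, and each of its members is directed in exactly one way.
  Distinct partial orientations of \<open>E\<close> thus correspond to distinct arc sets.
\<close>

definition partial_orientation :: "nat set set \<Rightarrow> (nat \<times> nat) set \<Rightarrow> bool" where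
  "partial_orientation E A \<longleftrightarrow> (\<forall>(u, v) \<in> A. {u, v} \<in> E \<and> (v, u) \<notin> A)"

definition herm_adj :: "nat \<Rightarrow> nat set set \<Rightarrow> (nat \<times> nat) set \<Rightarrow> complex mat" where
  "herm_adj n E A = mat n n (\<lambda>(u, v).
     if {u, v} \<in> E then
       (if (u, v) \<in> A then \<i> else if (v, u) \<in> A then - \<i> else 1)
     else 0)"

text \<open>
  A cycle with a direction of traversal is the list of its vertices; the index is taken modulo
  the length in order to include the closing edge.
\<close>

definition gain :: "nat \<Rightarrow> nat set set \<Rightarrow> (nat \<times> nat) set \<Rightarrow> nat list \<Rightarrow> complex" where
  "gain n E A us =
     (\<Prod>i<length us. herm_adj n E A $$ (us ! i, us ! (Suc i mod length us)))"

definition switching_equivalent ::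
    "nat \<Rightarrow> nat set set \<Rightarrow> (nat \<times> nat) set \<Rightarrow> (nat \<times> nat) set \<Rightarrow> bool" where
  "switching_equivalent n E A B \<longleftrightarrow>
     (\<exists>D D'. D \<in> carrier_mat n n \<and> D' \<in> carrier_mat n n \<and>
        diagonal_mat D \<and> (\<forall>i<n. D $$ (i, i) \<in> {1, -1, \<i>, - \<i>}) \<and>
        inverts_mat D D' \<and> inverts_mat D' D \<and>
        D' * herm_adj n E A * D = herm_adj n E B)"

definition switching_class ::
    "nat \<Rightarrow> nat set set \<Rightarrow> (nat \<times> nat) set \<Rightarrow> (nat \<times> nat) set set" where
  "switching_class n E A = {B. partial_orientation E B \<and> switching_equivalent n E A B}"

text \<open>
  The direction of traversal of \<open>C\<^sub>n\<close> is fixed to be \<open>0, 1, \<dots>, n - 1, 0\<close>; reversing it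
  conjugates the gain.
\<close>

abbreviation cycle_gain :: "nat \<Rightarrow> (nat \<times> nat) set \<Rightarrow> complex" where
  "cycle_gain n A \<equiv> gain n (cycle_edges n) A [0..<n]"

end

theory Submission imports Defs "HOL-Library.FuncSet" begin

text \<open>
  Write a mixed cycle as its sequence of weights \<open>h k (k + 1)\<close>, indices modulo \<open>n\<close>. As \<open>n \<ge> 3\<close>, the
  two arcs over an edge are distinct from each other and from the arcs over any other edge, so the
  weights can be chosen freely: partial orientations of \<open>C\<^sub>n\<close> correspond bijectively to the sequences
  of length \<open>n\<close> over \<open>{1, \<i>, -\<i>}\<close> (\<open>bij_betw_orientations_weights\<close>).

  Switching by a diagonal matrix with entries \<open>d k\<close> multiplies the weight of edge \<open>k\<close> by
  \<open>d (k + 1) / d k\<close>. These factors cancel around the cycle, so the gain is invariant. Conversely, if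
  two mixed cycles have the same gain, then the quotients of their partial products of weights give
  a suitable \<open>d\<close>; equality of the gains is what makes the closing edge agree. Hence the switching
  class consists of all mixed cycles with the same gain (\<open>switching_equivalent_cycle_iff\<close>), and it
  remains to count the sequences over \<open>{1, \<i>, -\<i>}\<close> whose product is a given fourth root of unity
  \<open>c\<close>.

  That count is a character sum: the four powers \<open>z \<mapsto> z ^ j\<close> are the characters of the group of
  fourth roots of unity, so the sum of \<open>c ^ (4 - j) * p ^ j\<close> over \<open>j\<close> is \<open>4\<close> if \<open>p = c\<close> and \<open>0\<close>
  otherwise. Summed over all sequences with \<open>p\<close> their product, the term for \<open>j\<close> becomes
  \<open>c ^ (4 - j) * (1 + \<i> ^ j + (-\<i>) ^ j) ^ n\<close>, where the base is \<open>3, 1, -1, 1\<close> for \<open>j = 0, 1, 2, 3\<close>.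
  So the count is \<open>(3 ^ n + c ^ 3 + (-1) ^ n * c ^ 2 + c) / 4\<close>
  (\<open>card_sequences_with_product\<close>).
\<close>

section \<open>Counting sequences with a given product\<close>

lemma fourth_root_of_unity_iff:
  fixes z :: complex
  shows "z \<in> {1, -1, \<i>, -\<i>} \<longleftrightarrow> z ^ 4 = 1"
proof -
  have "z ^ 4 - 1 = (z - 1) * (z + 1) * (z - \<i>) * (z + \<i>)"
    by (simp add: algebra_simps power4_eq_xxxx)
  then show ?thesis
    by (smt (verit) add_eq_0_iff2 eq_iff_diff_eq_0 insert_iff mult_eq_0_iff singletonD)
qed

lemma cnj_fourth_root_mult_self:
  assumes "(z::complex) ^ 4 = 1"
  shows "cnj z * z = 1"
proof -
  have "z \<in> {1, -1, \<i>, -\<i>}" using assms fourth_root_of_unity_iff by blast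
  then show ?thesis by auto
qed

text \<open>Orthogonality of the characters of the cyclic group of order four.\<close>

lemma fourth_roots_orthogonality:
  fixes p c :: complex
  assumes "p ^ 4 = 1" "c ^ 4 = 1"
  shows "1 + c ^ 3 * p + c ^ 2 * p ^ 2 + c * p ^ 3 = (if p = c then 4 else 0)"
proof -
  have "p \<in> {1, -1, \<i>, -\<i>}" "c \<in> {1, -1, \<i>, -\<i>}"
    using assms fourth_root_of_unity_iff by blast+
  then show ?thesis
    by (auto simp: power2_eq_square power3_eq_cube complex_eq_iff)
qed

lemma card_sequences_with_product:
  fixes c :: complex and n :: nat
  assumes c: "c ^ 4 = 1"
  defines "W \<equiv> {..<n} \<rightarrow>\<^sub>E {1, \<i>, -\<i>}"
  shows "4 * of_nat (card {w \<in> W. (\<Prod>k<n. w k) = c}) = 3 ^ n + c ^ 3 + (-1) ^ n * c ^ 2 + c"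
proof -
  have fin: "finite W"
    unfolding W_def by (intro finite_PiE) auto
  have root: "(\<Prod>k<n. w k) ^ 4 = 1" if "w \<in> W" for w
  proof -
    have "w k ^ 4 = 1" if "k < n" for k
      using \<open>w \<in> W\<close> that unfolding W_def
      by (metis PiE_mem fourth_root_of_unity_iff insert_iff lessThan_iff singletonD)
    then show ?thesis by (simp add: prod_power_distrib)
  qed
  have character_sum:
    "(\<Sum>w\<in>W. (\<Prod>k<n. w k) ^ j) = (1 + \<i> ^ j + (-\<i>) ^ j) ^ n" for j
  proof -
    have "(\<Sum>w\<in>W. (\<Prod>k<n. w k) ^ j) = (\<Sum>w\<in>W. \<Prod>k<n. w k ^ j)"
      by (simp add: prod_power_distrib)
    also have "\<dots> = (\<Prod>k<n. \<Sum>a\<in>{1, \<i>, -\<i>}. a ^ j)"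
      unfolding W_def by (subst prod_sum_PiE) auto
    also have "(\<Sum>a\<in>{1, \<i>, -\<i>}. a ^ j) = 1 + \<i> ^ j + (-\<i>) ^ j"
      by (simp add: complex_eq_iff)
    finally show ?thesis by simp
  qed
  have "4 * of_nat (card {w \<in> W. (\<Prod>k<n. w k) = c})
      = (\<Sum>w\<in>W. if (\<Prod>k<n. w k) = c then 4 else 0 :: complex)"
    using fin by (simp add: sum.If_cases Int_def)
  also have "\<dots> = (\<Sum>w\<in>W. 1 + c ^ 3 * (\<Prod>k<n. w k) + c ^ 2 * (\<Prod>k<n. w k) ^ 2
      + c * (\<Prod>k<n. w k) ^ 3)"
    using root c by (intro sum.cong) (simp_all add: fourth_roots_orthogonality)
  also have "\<dots> = (\<Sum>w\<in>W. (\<Prod>k<n. w k) ^ 0) + c ^ 3 * (\<Sum>w\<in>W. (\<Prod>k<n. w k) ^ 1)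
      + c ^ 2 * (\<Sum>w\<in>W. (\<Prod>k<n. w k) ^ 2) + c * (\<Sum>w\<in>W. (\<Prod>k<n. w k) ^ 3)"
    by (simp add: sum.distrib sum_distrib_left)
  also have "\<dots> = 3 ^ n + c ^ 3 + (-1) ^ n * c ^ 2 + c"
    unfolding character_sum by (simp add: power3_eq_cube)
  finally show ?thesis .
qed

section \<open>Switching in terms of matrix entries\<close>

lemma herm_adj_carrier [simp]: "herm_adj n E A \<in> carrier_mat n n"
  by (simp add: herm_adj_def)

lemma herm_adj_Hermitian:
  assumes "partial_orientation E A" "u < n" "v < n"
  shows "herm_adj n E A $$ (v, u) = cnj (herm_adj n E A $$ (u, v))"
  using assms by (auto simp: herm_adj_def partial_orientation_def insert_commute)

text \<open>
  Clearing the inverse turns \<open>D\<^sup>-\<^sup>1 H D = H'\<close> into \<open>H D = D H'\<close>, which can be read off entry by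
  entry.
\<close>

lemma switching_equivalent_iff_entries:
  "switching_equivalent n E A B \<longleftrightarrow>
    (\<exists>d. (\<forall>i<n. d i ^ 4 = 1) \<and>
      (\<forall>u<n. \<forall>v<n. herm_adj n E A $$ (u, v) * d v = d u * herm_adj n E B $$ (u, v)))"
  (is "?L \<longleftrightarrow> ?R")
proof
  assume ?L
  then obtain D D' where D: "D \<in> carrier_mat n n" "D' \<in> carrier_mat n n" "diagonal_mat D"
    and roots: "\<forall>i<n. D $$ (i, i) \<in> {1, -1, \<i>, -\<i>}"
    and inv: "inverts_mat D D'"
    and eq: "D' * herm_adj n E A * D = herm_adj n E B"
    unfolding switching_equivalent_def by blast
  define d where "d = (\<lambda>i. D $$ (i, i))"
  have Dd: "D = mat_diag n d"
    using D unfolding d_def diagonal_mat_def by (intro eq_matI) (auto simp: mat_diag_def)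
  have "D * herm_adj n E B = (D * D') * (herm_adj n E A * D)"
    unfolding eq[symmetric] using D
    by (simp add: assoc_mult_mat[of _ n n _ n _ n] mult_carrier_mat[of _ n n _ n])
  also have "\<dots> = herm_adj n E A * D"
    using inv D unfolding inverts_mat_def
    by (metis carrier_matD(1) herm_adj_carrier left_mult_one_mat mult_carrier_mat)
  finally have comm: "mat_diag n d * herm_adj n E B = herm_adj n E A * mat_diag n d"
    unfolding Dd .
  have "herm_adj n E A $$ (u, v) * d v = d u * herm_adj n E B $$ (u, v)"
    if "u < n" "v < n" for u v
    using arg_cong[OF comm, of "\<lambda>M. M $$ (u, v)"] that
    by (simp add: mat_diag_mult_left[OF herm_adj_carrier] mat_diag_mult_right[OF herm_adj_carrier])
  moreover have "\<forall>i<n. d i ^ 4 = 1"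
    using roots fourth_root_of_unity_iff unfolding d_def by blast
  ultimately show ?R by blast
next
  assume ?R
  then obtain d where roots: "\<And>i. i < n \<Longrightarrow> d i ^ 4 = 1"
    and entries: "\<And>u v. u < n \<Longrightarrow> v < n \<Longrightarrow>
      herm_adj n E A $$ (u, v) * d v = d u * herm_adj n E B $$ (u, v)"
    by blast
  define D where "D = mat_diag n d"
  define D' where "D' = mat_diag n (\<lambda>i. inverse (d i))"
  have nz: "d i \<noteq> 0" if "i < n" for i
    using roots[OF that] by auto
  have inv: "D * D' = 1\<^sub>m n" "D' * D = 1\<^sub>m n"
    unfolding D_def D'_def mat_diag_diag using nz by (auto intro!: eq_matI simp: mat_diag_def)
  have "(D' * herm_adj n E A * D) $$ (u, v) = herm_adj n E B $$ (u, v)"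
    if "u < n" "v < n" for u v
  proof -
    have "(D' * herm_adj n E A * D) $$ (u, v) = inverse (d u) * (herm_adj n E A $$ (u, v) * d v)"
      using that unfolding D_def D'_def
      by (simp add: mat_diag_mult_left[OF herm_adj_carrier]
          mat_diag_mult_right[where nr = n])
    then show ?thesis using entries nz that by simp
  qed
  then have "D' * herm_adj n E A * D = herm_adj n E B"
    by (intro eq_matI) (auto simp: D_def D'_def herm_adj_def mat_diag_def)
  moreover have "\<forall>i<n. D $$ (i, i) \<in> {1, -1, \<i>, -\<i>}"
    using roots fourth_root_of_unity_iff by (simp add: D_def mat_diag_def)
  moreover have "D \<in> carrier_mat n n" "D' \<in> carrier_mat n n" "diagonal_mat D"
    by (auto simp: D_def D'_def diagonal_mat_def mat_diag_def)
  moreover have "inverts_mat D D'" "inverts_mat D' D"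
    using inv unfolding inverts_mat_def D_def D'_def by (auto simp: mat_diag_def)
  ultimately show ?L
    unfolding switching_equivalent_def by blast
qed

section \<open>Mixed cycles as weight sequences\<close>

definition weight :: "nat \<Rightarrow> (nat \<times> nat) set \<Rightarrow> nat \<Rightarrow> complex" where
  "weight n A k =
     (if (k, Suc k mod n) \<in> A then \<i> else if (Suc k mod n, k) \<in> A then -\<i> else 1)"

lemma weight_in: "weight n A k \<in> {1, \<i>, -\<i>}"
  by (simp add: weight_def)

lemma weight_fourth_root: "weight n A k ^ 4 = 1"
  using weight_in fourth_root_of_unity_iff by blast

lemma cycle_edge_iff:
  assumes "u < n" "v < n"
  shows "{u, v} \<in> cycle_edges n \<longleftrightarrow> v = Suc u mod n \<or> u = Suc v mod n"
  using assms unfolding cycle_edges_def by (auto simp: doubleton_eq_iff)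

lemma herm_adj_cycle:
  assumes "k < n"
  shows "herm_adj n (cycle_edges n) A $$ (k, Suc k mod n) = weight n A k"
  using assms by (auto simp: herm_adj_def weight_def cycle_edge_iff)

lemma cycle_gain_eq_prod_weight: "cycle_gain n A = (\<Prod>k<n. weight n A k)"
  unfolding gain_def by (intro prod.cong) (auto simp: herm_adj_cycle)

lemma cycle_gain_fourth_root: "cycle_gain n A ^ 4 = 1"
  by (simp add: cycle_gain_eq_prod_weight prod_power_distrib weight_fourth_root)

lemma arcs_of_cycle:
  assumes "partial_orientation (cycle_edges n) A" "(u, v) \<in> A"
  obtains k where "k < n" "(u, v) = (k, Suc k mod n) \<or> (u, v) = (Suc k mod n, k)"
  using assms unfolding partial_orientation_def cycle_edges_def
  by (fastforce simp: doubleton_eq_iff)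

text \<open>
  This is where length at least three enters: on a cycle of length two, edge \<open>k + 1\<close> traversed
  forwards is edge \<open>k\<close> traversed backwards, so the weights could not be chosen independently.
\<close>

lemma Suc_Suc_mod_neq:
  assumes "n \<ge> 3" "k < n"
  shows "Suc (Suc k mod n) mod n \<noteq> k"
  using assms by (auto simp: mod_Suc)

text \<open>The inverse of passing from an orientation to its weight sequence.\<close>

definition arcs_of_weights :: "nat \<Rightarrow> (nat \<Rightarrow> complex) \<Rightarrow> (nat \<times> nat) set" where
  "arcs_of_weights n w =
     {(k, Suc k mod n) | k. k < n \<and> w k = \<i>} \<union> {(Suc k mod n, k) | k. k < n \<and> w k = -\<i>}"

lemma arcs_of_weights_forward:
  assumes "n \<ge> 3" "k < n"
  shows "(k, Suc k mod n) \<in> arcs_of_weights n w \<longleftrightarrow> w k = \<i>"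
  using assms Suc_Suc_mod_neq[OF assms] unfolding arcs_of_weights_def by auto

lemma arcs_of_weights_backward:
  assumes "n \<ge> 3" "k < n"
  shows "(Suc k mod n, k) \<in> arcs_of_weights n w \<longleftrightarrow> w k = -\<i>"
  using assms Suc_Suc_mod_neq[OF assms] unfolding arcs_of_weights_def by auto

lemma bij_betw_orientations_weights:
  assumes n: "n \<ge> 3"
  shows "bij_betw (\<lambda>A. restrict (weight n A) {..<n})
    {A. partial_orientation (cycle_edges n) A} ({..<n} \<rightarrow>\<^sub>E {1, \<i>, -\<i>})"
proof (rule bij_betw_byWitness[where f' = "arcs_of_weights n"])
  have "arcs_of_weights n (restrict (weight n A) {..<n}) = A"
    if A: "partial_orientation (cycle_edges n) A" for A
  proof -
    have "(k, Suc k mod n) \<in> A \<longleftrightarrow> weight n A k = \<i>"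
      "(Suc k mod n, k) \<in> A \<longleftrightarrow> weight n A k = -\<i>" for k
      using A by (auto simp: weight_def partial_orientation_def complex_eq_iff)
    then have "arcs_of_weights n (restrict (weight n A) {..<n})
        = {(k, Suc k mod n) | k. k < n \<and> (k, Suc k mod n) \<in> A}
          \<union> {(Suc k mod n, k) | k. k < n \<and> (Suc k mod n, k) \<in> A}"
      unfolding arcs_of_weights_def by auto
    also have "\<dots> = A"
    proof (intro equalityI subrelI)
      fix u v assume uv: "(u, v) \<in> A"
      obtain k where "k < n" "(u, v) = (k, Suc k mod n) \<or> (u, v) = (Suc k mod n, k)"
        using arcs_of_cycle[OF A uv] .
      with uv show "(u, v) \<in> {(k, Suc k mod n) | k. k < n \<and> (k, Suc k mod n) \<in> A}
          \<union> {(Suc k mod n, k) | k. k < n \<and> (Suc k mod n, k) \<in> A}"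
        by auto
    qed auto
    finally show ?thesis .
  qed
  then show "\<forall>A\<in>{A. partial_orientation (cycle_edges n) A}.
      arcs_of_weights n (restrict (weight n A) {..<n}) = A"
    by blast
next
  have "restrict (weight n (arcs_of_weights n w)) {..<n} = w"
    if w: "w \<in> {..<n} \<rightarrow>\<^sub>E {1, \<i>, -\<i>}" for w
  proof
    fix k
    show "restrict (weight n (arcs_of_weights n w)) {..<n} k = w k"
    proof (cases "k < n")
      case True
      then have "w k \<in> {1, \<i>, -\<i>}" using w by blast
      with True show ?thesis
        by (auto simp: weight_def arcs_of_weights_forward[OF n] arcs_of_weights_backward[OF n])
    next
      case False
      then show ?thesis using PiE_arb[OF w, of k] by simp
    qed
  qed
  then show "\<forall>w\<in>{..<n} \<rightarrow>\<^sub>E {1, \<i>, -\<i>}. restrict (weight n (arcs_of_weights n w)) {..<n} = w"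
    by blast
next
  show "(\<lambda>A. restrict (weight n A) {..<n}) ` {A. partial_orientation (cycle_edges n) A}
      \<subseteq> {..<n} \<rightarrow>\<^sub>E {1, \<i>, -\<i>}"
    by (intro image_subsetI restrict_PiE_iff[THEN iffD2] ballI weight_in)
next
  have "partial_orientation (cycle_edges n) (arcs_of_weights n w)" for w
  proof -
    have "{u, v} \<in> cycle_edges n \<and> (v, u) \<notin> arcs_of_weights n w"
      if "(u, v) \<in> arcs_of_weights n w" for u v
    proof -
      from that obtain k where k: "k < n"
        "(u, v) = (k, Suc k mod n) \<and> w k = \<i> \<or> (u, v) = (Suc k mod n, k) \<and> w k = -\<i>"
        unfolding arcs_of_weights_def by blast
      then have "(v, u) \<notin> arcs_of_weights n w"
        by (auto simp: arcs_of_weights_forward[OF n] arcs_of_weights_backward[OF n])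
      moreover have "{u, v} \<in> cycle_edges n"
        using k unfolding cycle_edges_def by auto
      ultimately show ?thesis by blast
    qed
    then show ?thesis unfolding partial_orientation_def by blast
  qed
  then show "arcs_of_weights n ` ({..<n} \<rightarrow>\<^sub>E {1, \<i>, -\<i>})
      \<subseteq> {A. partial_orientation (cycle_edges n) A}"
    by blast
qed

section \<open>The gain determines the switching class\<close>

text \<open>
  The equation at \<open>(v, u)\<close> is the complex conjugate of the one at \<open>(u, v)\<close>, because both matrices
  are Hermitian and the \<open>d k\<close> have modulus one. Each edge thus contributes a single condition.
\<close>

lemma switching_equivalent_cycle_iff_weights:
  assumes A: "partial_orientation (cycle_edges n) A" and B: "partial_orientation (cycle_edges n) B"
  shows "switching_equivalent n (cycle_edges n) A B \<longleftrightarrow>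
    (\<exists>d. (\<forall>k<n. d k ^ 4 = 1) \<and>
      (\<forall>k<n. weight n A k * d (Suc k mod n) = d k * weight n B k))"
proof -
  let ?E = "cycle_edges n"
  have "(\<forall>u<n. \<forall>v<n. herm_adj n ?E A $$ (u, v) * d v = d u * herm_adj n ?E B $$ (u, v))
      \<longleftrightarrow> (\<forall>k<n. weight n A k * d (Suc k mod n) = d k * weight n B k)"
    (is "?L \<longleftrightarrow> ?R") if d: "\<forall>k<n. d k ^ 4 = 1" for d
  proof
    assume L: ?L
    show ?R
    proof (intro allI impI)
      fix k assume "k < n"
      then show "weight n A k * d (Suc k mod n) = d k * weight n B k"
        using L by (metis herm_adj_cycle less_zeroE mod_less_divisor neq0_conv)
    qed
  next
    assume R: ?R
    have reverse: "herm_adj n ?E A $$ (v, u) * d u = d v * herm_adj n ?E B $$ (v, u)"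
      if uv: "u < n" "v < n"
        and eq: "herm_adj n ?E A $$ (u, v) * d v = d u * herm_adj n ?E B $$ (u, v)" for u v
    proof -
      have unit: "cnj (d u) * d u = 1" "cnj (d v) * d v = 1"
        using d uv cnj_fourth_root_mult_self by auto
      have "herm_adj n ?E A $$ (v, u) * cnj (d v) = cnj (d u) * herm_adj n ?E B $$ (v, u)"
        using arg_cong[OF eq, of cnj] by (simp add: herm_adj_Hermitian[OF A uv] herm_adj_Hermitian[OF B uv])
      then have "herm_adj n ?E A $$ (v, u) * (cnj (d v) * d v) * d u
          = (cnj (d u) * d u) * d v * herm_adj n ?E B $$ (v, u)"
        by (simp add: mult_ac)
      then show ?thesis by (simp add: unit)
    qed
    show ?L
    proof (intro allI impI)
      fix u v assume uv: "u < n" "v < n"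
      consider "v = Suc u mod n" | "u = Suc v mod n" | "{u, v} \<notin> ?E"
        using cycle_edge_iff[OF uv] by blast
      then show "herm_adj n ?E A $$ (u, v) * d v = d u * herm_adj n ?E B $$ (u, v)"
      proof cases
        case 1
        with R uv show ?thesis by (simp add: herm_adj_cycle)
      next
        case 2
        with R uv show ?thesis by (intro reverse[OF uv(2,1)]) (simp add: herm_adj_cycle)
      next
        case 3
        with uv show ?thesis by (simp add: herm_adj_def)
      qed
    qed
  qed
  then show ?thesis
    unfolding switching_equivalent_iff_entries by blast
qed

lemma prod_rotate:
  fixes f :: "nat \<Rightarrow> 'a :: comm_monoid_mult"
  shows "(\<Prod>k<n. f (Suc k mod n)) = (\<Prod>k<n. f k)"
proof (cases n)
  case (Suc m)
  have "(\<Prod>k<Suc m. f (Suc k mod Suc m)) = (\<Prod>k<m. f (Suc k)) * f 0"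
    by simp
  also have "\<dots> = (\<Prod>k<Suc m. f k)"
    unfolding prod.lessThan_Suc_shift by (simp add: mult.commute)
  finally show ?thesis using Suc by simp
qed simp

text \<open>
  Multiplying the edge conditions around the cycle cancels every \<open>d k\<close>, which gives equal gains.
  Conversely, starting from \<open>d 0 = 1\<close>, the edge conditions force \<open>d k\<close> to be the product of
  the first \<open>k\<close> quotients of weights, and equal gains are exactly what closes the recursion up.
\<close>

lemma switching_equivalent_cycle_iff:
  assumes A: "partial_orientation (cycle_edges n) A" and B: "partial_orientation (cycle_edges n) B"
  shows "switching_equivalent n (cycle_edges n) A B \<longleftrightarrow> cycle_gain n B = cycle_gain n A"
proof
  have nz: "weight n C k \<noteq> 0" for C k
    by (simp add: weight_def)
  {
    assume "switching_equivalent n (cycle_edges n) A B"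
    then obtain d where roots: "\<forall>k<n. d k ^ 4 = 1"
      and switch: "\<forall>k<n. weight n A k * d (Suc k mod n) = d k * weight n B k"
      unfolding switching_equivalent_cycle_iff_weights[OF A B] by blast
    have "(\<Prod>k<n. d k) \<noteq> 0"
      using roots by auto
    moreover have "cycle_gain n A * (\<Prod>k<n. d k) = (\<Prod>k<n. weight n A k * d (Suc k mod n))"
      unfolding cycle_gain_eq_prod_weight prod.distrib by (subst prod_rotate) simp
    moreover have "\<dots> = (\<Prod>k<n. d k) * cycle_gain n B"
      unfolding cycle_gain_eq_prod_weight prod.distrib[symmetric] using switch by auto
    ultimately show "cycle_gain n B = cycle_gain n A"
      by simp
  }
  {
    assume gain: "cycle_gain n B = cycle_gain n A"
    define d where "d k = (\<Prod>j<k. weight n B j / weight n A j)" for k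
    have "d k ^ 4 = 1" for k
      by (simp add: d_def prod_power_distrib power_divide weight_fourth_root)
    moreover have "weight n A k * d (Suc k mod n) = d k * weight n B k" if "k < n" for k
    proof -
      have "d n = cycle_gain n B / cycle_gain n A"
        by (simp add: d_def cycle_gain_eq_prod_weight prod_dividef)
      also have "\<dots> = 1"
        using cycle_gain_fourth_root[of n A] by (auto simp: gain)
      \<comment> \<open>At the closing edge \<open>k = n - 1\<close> the next step says \<open>d 0 = d n\<close>; elsewhere it is trivial.\<close>
      finally have "d (Suc k mod n) = d (Suc k)"
        using that by (auto simp: mod_Suc d_def)
      then show ?thesis
        using nz by (simp add: d_def)
    qed
    ultimately show "switching_equivalent n (cycle_edges n) A B"
      unfolding switching_equivalent_cycle_iff_weights[OF A B] by blast
  }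
qed

lemma card_switching_class_cycle:
  assumes n: "n \<ge> 3" and A: "partial_orientation (cycle_edges n) A"
  defines "c \<equiv> cycle_gain n A"
  shows "4 * of_nat (card (switching_class n (cycle_edges n) A))
    = 3 ^ n + c ^ 3 + (-1) ^ n * c ^ 2 + c"
proof -
  let ?f = "\<lambda>B. restrict (weight n B) {..<n}"
  let ?W = "{..<n} \<rightarrow>\<^sub>E {1, \<i>, -\<i>}"
  let ?P = "{B. partial_orientation (cycle_edges n) B}"
  have bij: "bij_betw ?f ?P ?W" by (rule bij_betw_orientations_weights[OF n])
  have class_eq: "switching_class n (cycle_edges n) A = {B \<in> ?P. cycle_gain n B = c}"
    unfolding switching_class_def c_def using switching_equivalent_cycle_iff[OF A] by blast
  have gain: "(\<Prod>k<n. ?f B k) = cycle_gain n B" for B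
    by (simp add: cycle_gain_eq_prod_weight)
  have "?f ` {B \<in> ?P. cycle_gain n B = c} = {w \<in> ?f ` ?P. (\<Prod>k<n. w k) = c}"
    unfolding gain[symmetric] by blast
  then have "?f ` {B \<in> ?P. cycle_gain n B = c} = {w \<in> ?W. (\<Prod>k<n. w k) = c}"
    using bij by (simp add: bij_betw_def)
  then have "card {B \<in> ?P. cycle_gain n B = c} = card {w \<in> ?W. (\<Prod>k<n. w k) = c}"
    by (intro bij_betw_same_card[OF bij_betw_subset[OF bij]]) auto
  then show ?thesis
    using card_sequences_with_product[of c n] cycle_gain_fourth_root
    by (simp add: class_eq c_def)
qed

theorem theorem4p4:
  fixes n :: nat and \<phi> :: "(nat \<times> nat) set"
  assumes "n \<ge> 3"
    and "partial_orientation (cycle_edges n) \<phi>"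
  shows "(odd n \<and> cycle_gain n \<phi> \<in> {1, \<i>, - \<i>} \<longrightarrow>
            real (card (switching_class n (cycle_edges n) \<phi>)) = (3 ^ n + 1) / 4) \<and>
         (odd n \<and> cycle_gain n \<phi> = -1 \<longrightarrow>
            real (card (switching_class n (cycle_edges n) \<phi>)) = (3 ^ n - 3) / 4) \<and>
         (even n \<and> cycle_gain n \<phi> = 1 \<longrightarrow>
            real (card (switching_class n (cycle_edges n) \<phi>)) = (3 ^ n + 3) / 4) \<and>
         (even n \<and> cycle_gain n \<phi> \<in> {-1, \<i>, - \<i>} \<longrightarrow>
            real (card (switching_class n (cycle_edges n) \<phi>)) = (3 ^ n - 1) / 4)"
proof -
  let ?c = "cycle_gain n \<phi>" and ?N = "card (switching_class n (cycle_edges n) \<phi>)"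
  have "4 * of_nat ?N = 3 ^ n + ?c ^ 3 + (-1) ^ n * ?c ^ 2 + ?c"
    using card_switching_class_cycle[OF assms] .
  then have "4 * real ?N = Re (3 ^ n + ?c ^ 3 + (-1) ^ n * ?c ^ 2 + ?c)"
    by (metis Re_complex_of_real of_real_mult of_real_numeral of_real_of_nat_eq)
  moreover have "Re (3 ^ n) = 3 ^ n"
    by (metis Re_complex_of_real of_real_numeral of_real_power)
  \<comment> \<open>What remains is to evaluate the formula at the four possible gains.\<close>
  ultimately show ?thesis
    by (auto simp: power2_eq_square power3_eq_cube)
qed

end
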